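(* For any constant $c>0$, there is, up to isomorphism, only a finite number of finite simple non-abelian groups $G$ containing a product-free set of size at least $c|G|$.
   Context: A subset $A$ of a group is product-free if there are no $x,y,z\in A$ with $xy=z$. *)

theory Defs
  imports "HOL-Algebra.Algebra" Complex_Main
begin

definition product_free :: "('a, 'b) monoid_scheme \<Rightarrow> 'a set \<Rightarrow> bool"
  where "product_free G A \<longleftrightarrow>
    A \<subseteq> carrier G \<and> (\<forall>x\<in>A. \<forall>y\<in>A. \<forall>z\<in>A. x \<otimes>\<^bsub>G\<^esub> y \<noteq> z)"

definition group_iso_on :: "'a monoid set \<Rightarrow> ('a monoid \<times> 'a monoid) set"
  where "group_iso_on \<G> = {(G, H). G \<in> \<G> \<and> H \<in> \<G> \<and> G \<cong> H}"

text \<open>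
  ``Finite up to isomorphism'' is finiteness of the set of isomorphism classes. The type of the
  group elements is a parameter, since HOL cannot collect groups over all types into one set.
  Nothing is lost: every finite group is isomorphic to one with elements in \<^typ>\<open>nat\<close>, so the
  instance at \<^typ>\<open>nat\<close> already covers all finite groups.
\<close>

definition finite_up_to_iso :: "'a monoid set \<Rightarrow> bool"
  where "finite_up_to_iso \<G> \<longleftrightarrow> finite (\<G> // group_iso_on \<G>)"

lemma equiv_group_iso_on:
  assumes "\<And>G. G \<in> \<G> \<Longrightarrow> group G"
  shows "equiv \<G> (group_iso_on \<G>)"
proof (rule equivI)
  show "group_iso_on \<G> \<subseteq> \<G> \<times> \<G>"
    by (auto simp: group_iso_on_def)
  show "refl_on \<G> (group_iso_on \<G>)"
    by (auto simp: refl_on_def group_iso_on_def intro: iso_refl)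
  show "sym (group_iso_on \<G>)"
    using assms by (auto simp: sym_def group_iso_on_def intro: group.iso_sym)
  show "trans (group_iso_on \<G>)"
    using assms by (auto simp: trans_def group_iso_on_def intro: iso_trans)
qed

end

theory Submission
  imports Defs "HOL-Analysis.Function_Topology" "HOL-Analysis.Convex"
begin

text \<open>
  Let \<open>A\<close> be product-free of density \<open>\<alpha>\<close> in \<open>G\<close>. The operator \<open>h \<mapsto> (x \<mapsto> \<Sum>y. 1\<^sub>A (x y) h y)\<close> sends
  \<open>1\<^sub>A - \<alpha>\<close> to a function equal to \<open>-\<alpha>\<^sup>2 |G|\<close> on \<open>A\<close>, so its norm on functions of sum zero is large,
  while its Hilbert--Schmidt norm is \<open>(\<alpha> |G|\<^sup>2)\<^sup>1\<^sup>/\<^sup>2\<close>. Hence the space of functions where the norm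
  is attained has dimension at most \<open>\<alpha>\<^sup>-\<^sup>3\<close>. It is translation-invariant and so carries a
  nontrivial orthogonal representation of \<open>G\<close>. A Jordan-type argument bounds the order of a
  non-abelian simple group with such a representation: an element nearest to the identity, if
  too near, would commute with all its conjugates; so all elements are well separated.
\<close>

section \<open>Finitely many groups of bounded order\<close>

text \<open>Numbering the elements turns a group into a multiplication table on an initial segment
  of the naturals. Equal tables force isomorphism, and only finitely many tables have entries below
  \<open>N\<close>.\<close>

lemma finite_up_to_iso_if_order_le:
  fixes \<G> :: "'a monoid set"
  assumes grp: "\<And>G. G \<in> \<G> \<Longrightarrow> group G"
    and fin: "\<And>G. G \<in> \<G> \<Longrightarrow> finite (carrier G)"
    and ord: "\<And>G. G \<in> \<G> \<Longrightarrow> order G \<le> N"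
  shows "finite_up_to_iso \<G>"
proof -
  have "\<exists>f. bij_betw f (carrier G) {0..<order G}" if "G \<in> \<G>" for G
    using ex_bij_betw_finite_nat[OF fin[OF that]] by (simp add: order_def)
  then obtain f where f: "\<And>G. G \<in> \<G> \<Longrightarrow> bij_betw (f G) (carrier G) {0..<order G}"
    by metis
  \<comment> \<open>The order fixes the range of the numbering; the triples are the graph of the
    multiplication in terms of numbers.\<close>
  define tbl where "tbl G = (order G, (\<lambda>(x, y). (f G x, f G y, f G (x \<otimes>\<^bsub>G\<^esub> y))) ` (carrier G \<times> carrier G))"
    for G :: "'a monoid"
  have tbl_iso: "G \<cong> H" if G: "G \<in> \<G>" and H: "H \<in> \<G>" and eq: "tbl G = tbl H" for G H
  proof -
    interpret G: group G by (rule grp[OF G])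
    interpret H: group H by (rule grp[OF H])
    define g where "g = inv_into (carrier H) (f H)"
    have ord_eq: "order G = order H"
      using eq by (simp add: tbl_def)
    have g: "bij_betw g {0..<order H} (carrier H)"
      unfolding g_def by (rule bij_betw_inv_into[OF f[OF H]])
    have g_f: "g (f H x) = x" if "x \<in> carrier H" for x
      unfolding g_def using bij_betw_inv_into_left[OF f[OF H] that] .
    have bij: "bij_betw (g \<circ> f G) (carrier G) (carrier H)"
      using bij_betw_trans[OF f[OF G]] g ord_eq by metis
    have "g (f G (x \<otimes>\<^bsub>G\<^esub> y)) = g (f G x) \<otimes>\<^bsub>H\<^esub> g (f G y)"
      if x: "x \<in> carrier G" and y: "y \<in> carrier G" for x y
    proof -
      have "(f G x, f G y, f G (x \<otimes>\<^bsub>G\<^esub> y)) \<in> snd (tbl G)"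
        using x y by (force simp: tbl_def)
      then obtain x' y' where "x' \<in> carrier H" "y' \<in> carrier H"
        "f G x = f H x'" "f G y = f H y'" "f G (x \<otimes>\<^bsub>G\<^esub> y) = f H (x' \<otimes>\<^bsub>H\<^esub> y')"
        unfolding eq by (auto simp: tbl_def)
      then show ?thesis
        by (simp add: g_f)
    qed
    moreover have "g (f G x) \<in> carrier H" if "x \<in> carrier G" for x
      using bij_betwE[OF bij] that by simp
    ultimately have "g \<circ> f G \<in> hom G H"
      by (auto simp: hom_def)
    then show ?thesis
      using bij by (auto simp: is_iso_def iso_def)
  qed
  have "tbl ` \<G> \<subseteq> {..N} \<times> Pow ({..<N} \<times> {..<N} \<times> {..<N})"
  proof
    fix t assume "t \<in> tbl ` \<G>"
    then obtain G where G: "G \<in> \<G>" and t: "t = tbl G" by auto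
    interpret group G by (rule grp[OF G])
    have "f G x < N" if "x \<in> carrier G" for x
      using bij_betwE[OF f[OF G]] ord[OF G] that by fastforce
    then show "t \<in> {..N} \<times> Pow ({..<N} \<times> {..<N} \<times> {..<N})"
      using ord[OF G] by (auto simp: t tbl_def)
  qed
  then have fin_tbl: "finite (tbl ` \<G>)"
    by (rule finite_subset) auto
  have equiv: "equiv \<G> (group_iso_on \<G>)"
    using grp by (rule equiv_group_iso_on)
  \<comment> \<open>A class is recovered from the table of any member, through a chosen group with
    that table.\<close>
  have "\<G> // group_iso_on \<G> \<subseteq> (\<lambda>t. group_iso_on \<G> `` {inv_into \<G> tbl t}) ` (tbl ` \<G>)"
  proof
    fix C assume "C \<in> \<G> // group_iso_on \<G>"
    then obtain G where G: "G \<in> \<G>" and C: "C = group_iso_on \<G> `` {G}"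
      by (rule quotientE)
    have H: "inv_into \<G> tbl (tbl G) \<in> \<G>" "tbl (inv_into \<G> tbl (tbl G)) = tbl G"
      using G by (auto intro: inv_into_into f_inv_into_f)
    have "(G, inv_into \<G> tbl (tbl G)) \<in> group_iso_on \<G>"
      using G H tbl_iso by (auto simp: group_iso_on_def)
    then have "C = group_iso_on \<G> `` {inv_into \<G> tbl (tbl G)}"
      unfolding C by (rule equiv_class_eq[OF equiv])
    then show "C \<in> (\<lambda>t. group_iso_on \<G> `` {inv_into \<G> tbl t}) ` (tbl ` \<G>)"
      using G by blast
  qed
  then show ?thesis
    unfolding finite_up_to_iso_def using fin_tbl by (meson finite_imageI finite_subset)
qed

section \<open>Orthogonal representations of simple groups\<close>

text \<open>If \<open>z\<close> commutes with \<open>inv x \<otimes> c \<otimes> x\<close>, which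
  lies in \<open>C\<close> again, then conjugating by \<open>x\<close> shows that
  \<open>x \<otimes> z \<otimes> inv x\<close> commutes with \<open>c\<close>.\<close>

lemma (in group) normal_centralizer:
  assumes C: "C \<subseteq> carrier G"
    and conj: "\<And>x c. x \<in> carrier G \<Longrightarrow> c \<in> C \<Longrightarrow> x \<otimes> c \<otimes> inv x \<in> C"
  shows "{z \<in> carrier G. \<forall>c\<in>C. z \<otimes> c = c \<otimes> z} \<lhd> G" (is "?Z \<lhd> G")
proof -
  have Z: "subgroup ?Z G"
  proof (rule subgroupI)
    show "?Z \<noteq> {}"
      using C by (auto intro!: exI[of _ \<one>])
  next
    fix a assume a: "a \<in> ?Z"
    have "inv a \<otimes> c = c \<otimes> inv a" if c: "c \<in> C" for c
    proof -
      have [simp]: "a \<in> carrier G" "c \<in> carrier G" using a c C by auto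
      have "inv a \<otimes> c = inv a \<otimes> (c \<otimes> a) \<otimes> inv a" by (simp add: m_assoc)
      also have "\<dots> = inv a \<otimes> (a \<otimes> c) \<otimes> inv a" using a c by simp
      also have "\<dots> = c \<otimes> inv a" by (simp flip: m_assoc)
      finally show ?thesis .
    qed
    then show "inv a \<in> ?Z" using a by auto
  next
    fix a b assume a: "a \<in> ?Z" and b: "b \<in> ?Z"
    have "a \<otimes> b \<otimes> c = c \<otimes> (a \<otimes> b)" if c: "c \<in> C" for c
    proof -
      have [simp]: "a \<in> carrier G" "b \<in> carrier G" "c \<in> carrier G" using a b c C by auto
      have "a \<otimes> b \<otimes> c = a \<otimes> (c \<otimes> b)" using b c by (simp add: m_assoc)
      also have "\<dots> = c \<otimes> (a \<otimes> b)" using a c by (simp flip: m_assoc)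
      finally show ?thesis .
    qed
    then show "a \<otimes> b \<in> ?Z" using a b by auto
  qed auto
  have "x \<otimes> z \<otimes> inv x \<in> ?Z" if x: "x \<in> carrier G" and z: "z \<in> ?Z" for x z
  proof -
    have "x \<otimes> z \<otimes> inv x \<otimes> c = c \<otimes> (x \<otimes> z \<otimes> inv x)" if c: "c \<in> C" for c
    proof -
      have [simp]: "x \<in> carrier G" "z \<in> carrier G" "c \<in> carrier G" using x z c C by auto
      define d where "d = inv x \<otimes> c \<otimes> x"
      have d: "d \<in> C" using conj[of "inv x" c] x c by (simp add: d_def)
      have [simp]: "d \<in> carrier G" using d C by auto
      have c_eq: "c = x \<otimes> d \<otimes> inv x"
        by (simp add: d_def m_assoc inv_solve_left' flip: m_assoc) (simp add: m_assoc)
      have "x \<otimes> z \<otimes> inv x \<otimes> c = x \<otimes> (z \<otimes> d) \<otimes> inv x"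
        unfolding c_eq by (simp add: m_assoc) (simp flip: m_assoc)
      also have "\<dots> = x \<otimes> (d \<otimes> z) \<otimes> inv x" using z d by simp
      also have "\<dots> = c \<otimes> (x \<otimes> z \<otimes> inv x)"
        unfolding c_eq by (simp add: m_assoc) (simp flip: m_assoc)
      finally show ?thesis .
    qed
    then show ?thesis using x z by auto
  qed
  with Z show ?thesis by (auto simp: normal_inv_iff)
qed

text \<open>Simplicity is used twice. The centralizer of the conjugacy class of \<open>g\<close> is
  normal and contains \<open>g\<close>, so it is the whole group and \<open>g\<close> is central.
  Then the center is normal and nontrivial, so it is the whole group too.\<close>

lemma (in simple_group) comm_group_if_commutes_conjugates:
  assumes g: "g \<in> carrier G" "g \<noteq> \<one>"
    and comm: "\<And>x. x \<in> carrier G \<Longrightarrow> g \<otimes> (x \<otimes> g \<otimes> inv x) = (x \<otimes> g \<otimes> inv x) \<otimes> g"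
  shows "comm_group G"
proof -
  define C where "C = (\<lambda>x. x \<otimes> g \<otimes> inv x) ` carrier G"
  have C: "C \<subseteq> carrier G" using g by (auto simp: C_def)
  have conj: "x \<otimes> c \<otimes> inv x \<in> C" if x: "x \<in> carrier G" and c: "c \<in> C" for x c
  proof -
    obtain y where y: "y \<in> carrier G" "c = y \<otimes> g \<otimes> inv y" using c by (auto simp: C_def)
    have "x \<otimes> c \<otimes> inv x = (x \<otimes> y) \<otimes> g \<otimes> inv (x \<otimes> y)"
      using x y g by (simp add: m_assoc inv_mult_group)
    then show ?thesis using x y by (auto simp: C_def)
  qed
  have "g \<in> {z \<in> carrier G. \<forall>c\<in>C. z \<otimes> c = c \<otimes> z}"
    using g comm by (auto simp: C_def)
  then have all: "{z \<in> carrier G. \<forall>c\<in>C. z \<otimes> c = c \<otimes> z} = carrier G"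
    using no_real_normal_subgroup[OF normal_centralizer[OF C conj]] g(2) by auto
  have "g \<in> C" using g by (auto simp: C_def image_def intro!: bexI[of _ \<one>])
  then have "z \<otimes> g = g \<otimes> z" if "z \<in> carrier G" for z
    using all that by blast
  then have "g \<in> {z \<in> carrier G. \<forall>c\<in>carrier G. z \<otimes> c = c \<otimes> z}"
    using g by simp
  moreover have "{z \<in> carrier G. \<forall>c\<in>carrier G. z \<otimes> c = c \<otimes> z} \<lhd> G"
    by (rule normal_centralizer) auto
  ultimately have "{z \<in> carrier G. \<forall>c\<in>carrier G. z \<otimes> c = c \<otimes> z} = carrier G"
    using no_real_normal_subgroup g(2) by blast
  then show ?thesis
    by (intro group_comm_groupI) auto
qed

section \<open>Matrices and the squared Frobenius norm\<close>

lemma sum_of_bool_mult: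
  fixes f :: "'b \<Rightarrow> real"
  assumes "finite S" "i \<in> S"
  shows "(\<Sum>l\<in>S. of_bool (i = l) * f l) = f i"
proof -
  have "(\<Sum>l\<in>S. of_bool (i = l) * f l) = (\<Sum>l\<in>S. if i = l then f l else 0)"
    by (intro sum.cong) auto
  then show ?thesis using assms by simp
qed

lemma sum_mult_of_bool:
  fixes f :: "'b \<Rightarrow> real"
  assumes "finite S" "j \<in> S"
  shows "(\<Sum>l\<in>S. f l * of_bool (l = j)) = f j"
  using sum_of_bool_mult[OF assms, of f] by (simp add: mult.commute eq_commute)

text \<open>The squared Frobenius norm. A matrix is a function on all index pairs, of which only
  those below \<open>k\<close> count.\<close>

definition frob2 :: "nat \<Rightarrow> (nat \<Rightarrow> nat \<Rightarrow> real) \<Rightarrow> real"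
  where "frob2 k A = (\<Sum>i<k. \<Sum>j<k. (A i j)\<^sup>2)"

lemma frob2_nonneg: "0 \<le> frob2 k A"
  by (simp add: frob2_def sum_nonneg)

text \<open>Cauchy-Schwarz bounds each entry of the product by a row norm times a column norm, and
  the resulting double sum factors.\<close>

lemma frob2_mult_le:
  "frob2 k (\<lambda>i j. \<Sum>l<k. A i l * B l j) \<le> frob2 k A * frob2 k B"
proof -
  have "frob2 k (\<lambda>i j. \<Sum>l<k. A i l * B l j)
      \<le> (\<Sum>i<k. \<Sum>j<k. (\<Sum>l<k. (A i l)\<^sup>2) * (\<Sum>l<k. (B l j)\<^sup>2))"
    unfolding frob2_def by (intro sum_mono Cauchy_Schwarz_ineq_sum)
  also have "\<dots> = frob2 k A * (\<Sum>j<k. \<Sum>l<k. (B l j)\<^sup>2)"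
    by (subst sum_product[symmetric]) (simp add: frob2_def)
  also have "(\<Sum>j<k. \<Sum>l<k. (B l j)\<^sup>2) = frob2 k B"
    unfolding frob2_def by (rule sum.swap)
  finally show ?thesis .
qed

lemma frob2_diff_le:
  "frob2 k (\<lambda>i j. A i j - B i j) \<le> 2 * frob2 k A + 2 * frob2 k B"
proof -
  have "(a - b)\<^sup>2 \<le> 2 * a\<^sup>2 + 2 * b\<^sup>2" for a b :: real
    using zero_le_power2[of "a + b"] by (simp add: power2_eq_square algebra_simps)
  then have "frob2 k (\<lambda>i j. A i j - B i j) \<le> (\<Sum>i<k. \<Sum>j<k. 2 * (A i j)\<^sup>2 + 2 * (B i j)\<^sup>2)"
    unfolding frob2_def by (intro sum_mono)
  then show ?thesis
    by (simp add: frob2_def sum.distrib sum_distrib_left)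
qed

text \<open>Orthogonality is encoded by \<open>rho_inv\<close>: the matrix of the inverse is the
  transpose.\<close>

locale orth_rep = group G for G (structure) +
  fixes k :: nat and \<rho> :: "'a \<Rightarrow> nat \<Rightarrow> nat \<Rightarrow> real"
  assumes rho_mult: "\<lbrakk>x \<in> carrier G; y \<in> carrier G; i < k; j < k\<rbrakk> \<Longrightarrow>
      \<rho> (x \<otimes> y) i j = (\<Sum>l<k. \<rho> x i l * \<rho> y l j)"
    and rho_one: "\<lbrakk>i < k; j < k\<rbrakk> \<Longrightarrow> \<rho> \<one> i j = of_bool (i = j)"
    and rho_inv: "\<lbrakk>x \<in> carrier G; i < k; j < k\<rbrakk> \<Longrightarrow> \<rho> (inv x) i j = \<rho> x j i"
begin

section \<open>Characters and displacement\<close>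

definition character :: "'a \<Rightarrow> real"
  where "character x = (\<Sum>i<k. \<rho> x i i)"

text \<open>The squared Frobenius distance of \<open>\<rho> x\<close> from the identity, see
  \<open>frob2_rho_minus_one\<close>. In the trace form its invariance under conjugation is
  immediate.\<close>

definition displ :: "'a \<Rightarrow> real"
  where "displ x = 2 * real k - 2 * character x"

lemma displ_one: "displ \<one> = 0"
  by (simp add: displ_def character_def rho_one)

lemma character_mult_commute:
  assumes "x \<in> carrier G" "y \<in> carrier G"
  shows "character (x \<otimes> y) = character (y \<otimes> x)"
proof -
  have "character (x \<otimes> y) = (\<Sum>i<k. \<Sum>l<k. \<rho> x i l * \<rho> y l i)"
    using assms by (simp add: character_def rho_mult)
  also have "\<dots> = (\<Sum>l<k. \<Sum>i<k. \<rho> y l i * \<rho> x i l)"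
    by (subst sum.swap) (simp add: mult.commute)
  also have "\<dots> = character (y \<otimes> x)"
    using assms by (simp add: character_def rho_mult)
  finally show ?thesis .
qed

lemma displ_conj:
  assumes "x \<in> carrier G" "g \<in> carrier G"
  shows "displ (x \<otimes> g \<otimes> inv x) = displ g"
proof -
  have "character (x \<otimes> (g \<otimes> inv x)) = character ((g \<otimes> inv x) \<otimes> x)"
    using assms by (intro character_mult_commute) auto
  then show ?thesis
    using assms by (simp add: displ_def m_assoc)
qed

text \<open>The Frobenius inner product of two matrices is the trace of the transpose of one times
  the other, and here the transpose belongs to \<open>inv x\<close>.\<close>

lemma sum_rho_product:
  assumes "x \<in> carrier G" "y \<in> carrier G"
  shows "(\<Sum>i<k. \<Sum>j<k. \<rho> x i j * \<rho> y i j) = character (inv x \<otimes> y)"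
proof -
  have "character (inv x \<otimes> y) = (\<Sum>j<k. \<Sum>i<k. \<rho> x i j * \<rho> y i j)"
    using assms by (simp add: character_def rho_mult rho_inv)
  also have "\<dots> = (\<Sum>i<k. \<Sum>j<k. \<rho> x i j * \<rho> y i j)"
    by (rule sum.swap)
  finally show ?thesis ..
qed

lemma frob2_rho_diff:
  assumes "x \<in> carrier G" "y \<in> carrier G"
  shows "frob2 k (\<lambda>i j. \<rho> x i j - \<rho> y i j) = displ (inv x \<otimes> y)"
proof -
  have norm: "(\<Sum>i<k. \<Sum>j<k. \<rho> z i j * \<rho> z i j) = real k" if "z \<in> carrier G" for z
    using sum_rho_product[OF that that] that displ_one by (simp add: displ_def)
  have "frob2 k (\<lambda>i j. \<rho> x i j - \<rho> y i j)
     = (\<Sum>i<k. \<Sum>j<k. \<rho> x i j * \<rho> x i j) + (\<Sum>i<k. \<Sum>j<k. \<rho> y i j * \<rho> y i j)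
       - 2 * (\<Sum>i<k. \<Sum>j<k. \<rho> x i j * \<rho> y i j)"
    by (simp add: frob2_def power2_eq_square algebra_simps sum.distrib sum_subtractf sum_distrib_left)
  then show ?thesis
    using assms by (simp add: norm sum_rho_product displ_def)
qed

lemma frob2_rho_minus_one:
  assumes "x \<in> carrier G"
  shows "frob2 k (\<lambda>i j. \<rho> x i j - of_bool (i = j)) = displ x"
proof -
  have "frob2 k (\<lambda>i j. \<rho> x i j - of_bool (i = j)) = frob2 k (\<lambda>i j. \<rho> x i j - \<rho> \<one> i j)"
    unfolding frob2_def by (intro sum.cong refl) (simp add: rho_one)
  also have "\<dots> = displ (inv x)"
    using assms by (simp add: frob2_rho_diff)
  also have "\<dots> = displ x"
    using assms by (simp add: displ_def character_def rho_inv)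
  finally show ?thesis .
qed

lemma displ_nonneg: "x \<in> carrier G \<Longrightarrow> 0 \<le> displ x"
  using frob2_rho_minus_one frob2_nonneg by metis

lemma rho_eq_one_if_displ_eq_0:
  assumes "x \<in> carrier G" "displ x = 0" "i < k" "j < k"
  shows "\<rho> x i j = of_bool (i = j)"
proof -
  have "(\<Sum>i<k. \<Sum>j<k. (\<rho> x i j - of_bool (i = j))\<^sup>2) = 0"
    using frob2_rho_minus_one[OF assms(1)] assms(2) by (simp add: frob2_def)
  then have "(\<Sum>j<k. (\<rho> x i j - of_bool (i = j))\<^sup>2) = 0"
    using assms(3) by (subst (asm) sum_nonneg_eq_0_iff) (auto intro: sum_nonneg)
  then show ?thesis
    using assms(4) by (subst (asm) sum_nonneg_eq_0_iff) auto
qed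

text \<open>
  Write \<open>A = \<rho> g - 1\<close> and \<open>B = \<rho> h - 1\<close>. Then \<open>\<rho> (g h) - \<rho> (h g) = A B - B A\<close>, so commutators
  of elements near the identity are much nearer to it.
\<close>

lemma displ_commutator_le:
  assumes g: "g \<in> carrier G" and h: "h \<in> carrier G"
  shows "displ (inv (g \<otimes> h) \<otimes> (h \<otimes> g)) \<le> 4 * displ g * displ h"
proof -
  define A where "A i j = \<rho> g i j - of_bool (i = j)" for i j
  define B where "B i j = \<rho> h i j - of_bool (i = j)" for i j
  define AB where "AB i j = (\<Sum>l<k. A i l * B l j)" for i j
  define BA where "BA i j = (\<Sum>l<k. B i l * A l j)" for i j
  have prod: "(\<Sum>l<k. (M i l - of_bool (i = l)) * (N l j - of_bool (l = j)))
      = (\<Sum>l<k. M i l * N l j) - M i j - N i j + of_bool (i = j)"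
    if "i < k" "j < k" for M N :: "nat \<Rightarrow> nat \<Rightarrow> real" and i j
    using that
    by (simp add: left_diff_distrib right_diff_distrib sum_subtractf sum_of_bool_mult
        sum_mult_of_bool)
  have "\<rho> (g \<otimes> h) i j - \<rho> (h \<otimes> g) i j = AB i j - BA i j" if "i < k" "j < k" for i j
    unfolding AB_def BA_def A_def B_def using that g h by (simp add: prod rho_mult)
  then have "frob2 k (\<lambda>i j. \<rho> (g \<otimes> h) i j - \<rho> (h \<otimes> g) i j) = frob2 k (\<lambda>i j. AB i j - BA i j)"
    by (simp add: frob2_def)
  then have "displ (inv (g \<otimes> h) \<otimes> (h \<otimes> g)) = frob2 k (\<lambda>i j. AB i j - BA i j)"
    using g h by (simp add: frob2_rho_diff)
  also have "\<dots> \<le> 2 * frob2 k AB + 2 * frob2 k BA"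
    by (rule frob2_diff_le)
  also have "\<dots> \<le> 2 * (frob2 k A * frob2 k B) + 2 * (frob2 k B * frob2 k A)"
    unfolding AB_def BA_def by (intro add_mono mult_left_mono frob2_mult_le) auto
  also have "\<dots> = 4 * displ g * displ h"
    using g h by (simp add: A_def[abs_def] B_def[abs_def] frob2_rho_minus_one)
  finally show ?thesis .
qed

text \<open>Zero displacement forces the identity matrix, so this set is the kernel of the
  representation.\<close>

lemma normal_kernel: "{x \<in> carrier G. displ x = 0} \<lhd> G"
proof -
  let ?K = "{x \<in> carrier G. displ x = 0}"
  have "subgroup ?K G"
  proof (rule subgroupI)
    show "?K \<noteq> {}" using displ_one by auto
  next
    fix a assume "a \<in> ?K"
    then show "inv a \<in> ?K"
      by (auto simp: displ_def character_def rho_inv)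
  next
    fix a b assume a: "a \<in> ?K" and b: "b \<in> ?K"
    then have "\<rho> (a \<otimes> b) i i = 1" if "i < k" for i
      using that by (simp add: rho_mult rho_eq_one_if_displ_eq_0 sum_of_bool_mult)
    then show "a \<otimes> b \<in> ?K"
      using a b by (simp add: displ_def character_def)
  qed auto
  then show ?thesis
    by (auto simp: normal_inv_iff displ_conj)
qed

text \<open>The rows of an orthogonal matrix are unit vectors: the squared norm of row
  \<open>i\<close> is a diagonal entry of \<open>\<rho> (x \<otimes> inv x)\<close>.\<close>

lemma abs_rho_le_1:
  assumes "x \<in> carrier G" "i < k" "j < k"
  shows "\<bar>\<rho> x i j\<bar> \<le> 1"
proof -
  have "(\<rho> x i j)\<^sup>2 \<le> (\<Sum>l<k. (\<rho> x i l)\<^sup>2)"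
    using assms by (intro member_le_sum) auto
  also have "\<dots> = (\<Sum>l<k. \<rho> x i l * \<rho> (inv x) l i)"
    using assms by (simp add: rho_inv power2_eq_square)
  also have "\<dots> = \<rho> (x \<otimes> inv x) i i"
    using assms by (subst rho_mult) auto
  also have "\<dots> = 1"
    using assms by (simp add: rho_one)
  finally show ?thesis
    by (simp add: abs_square_le_1)
qed

text \<open>Two matrices with the same entries up to rounding are at small distance: pigeonhole.\<close>

lemma order_le_if_displ_ge:
  assumes ge: "\<And>x. x \<in> carrier G \<Longrightarrow> x \<noteq> \<one> \<Longrightarrow> 1 / 4 \<le> displ x"
  shows "order G \<le> (4 * k + 3) ^ k\<^sup>2"
proof -
  \<comment> \<open>With \<open>k\<^sup>2\<close> entries each off by at most \<open>1 / m\<close>,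
    the squared distance is at most \<open>(k / m)\<^sup>2\<close>; this \<open>m\<close> makes it
    less than \<open>1 / 4\<close>.\<close>
  define m where "m = 2 * k + 1"
  define P where "P = {..<k} \<times> {..<k}"
  define cell where "cell x = (\<lambda>p\<in>P. \<lfloor>real m * \<rho> x (fst p) (snd p)\<rfloor>)" for x
  have m: "real m > 0" by (simp add: m_def)
  have "inj_on cell (carrier G)"
  proof (rule inj_onI, rule ccontr)
    fix x y assume x: "x \<in> carrier G" and y: "y \<in> carrier G" and eq: "cell x = cell y" and ne: "x \<noteq> y"
    have "(\<rho> x i j - \<rho> y i j)\<^sup>2 \<le> (1 / real m)\<^sup>2" if "i < k" "j < k" for i j
    proof -
      have "\<lfloor>real m * \<rho> x i j\<rfloor> = \<lfloor>real m * \<rho> y i j\<rfloor>"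
        using fun_cong[OF eq, of "(i, j)"] that by (simp add: cell_def P_def)
      then have "\<bar>real m * \<rho> x i j - real m * \<rho> y i j\<bar> \<le> 1"
        by linarith
      then have "real m * \<bar>\<rho> x i j - \<rho> y i j\<bar> \<le> 1"
        by (simp add: abs_mult flip: right_diff_distrib)
      then have "\<bar>\<rho> x i j - \<rho> y i j\<bar> \<le> 1 / real m"
        using m by (simp add: pos_le_divide_eq mult.commute)
      then show ?thesis
        using m by (metis abs_ge_zero power2_abs power_mono)
    qed
    then have "frob2 k (\<lambda>i j. \<rho> x i j - \<rho> y i j) \<le> (\<Sum>i<k. \<Sum>j<k. (1 / real m)\<^sup>2)"
      unfolding frob2_def by (intro sum_mono) auto
    also have "\<dots> = (real k / real m)\<^sup>2"
      by (simp add: power2_eq_square)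
    also have "\<dots> < (1 / 2)\<^sup>2"
      by (intro power_strict_mono) (auto simp: m_def field_simps)
    finally have "displ (inv x \<otimes> y) < 1 / 4"
      using x y by (simp add: frob2_rho_diff power2_eq_square)
    moreover have "inv x \<otimes> y \<noteq> \<one>"
      using x y ne by (metis inv_closed inv_equality inv_inv)
    ultimately show False
      using ge[of "inv x \<otimes> y"] x y by auto
  qed
  moreover have "cell ` carrier G \<subseteq> (\<Pi>\<^sub>E p\<in>P. {- int m..int m})"
  proof -
    have "\<lfloor>real m * \<rho> x i j\<rfloor> \<in> {- int m..int m}" if "x \<in> carrier G" "i < k" "j < k" for x i j
    proof -
      have "\<bar>real m * \<rho> x i j\<bar> \<le> real m"
        using abs_rho_le_1[OF that] m by (simp add: abs_mult mult_left_le)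
      then show ?thesis by (auto simp: abs_le_iff) linarith+
    qed
    then show ?thesis by (force simp: cell_def P_def)
  qed
  ultimately have "card (carrier G) \<le> card (\<Pi>\<^sub>E p\<in>P. {- int m..int m})"
    by (intro card_inj_on_le[of cell]) (auto intro: finite_PiE simp: P_def)
  \<comment> \<open>Each of the \<open>k\<^sup>2\<close> entries has
    \<open>2 * m + 1 = 4 * k + 3\<close> possible rounded values.\<close>
  also have "\<dots> = (4 * k + 3) ^ k\<^sup>2"
    by (simp add: card_PiE P_def m_def power2_eq_square nat_add_distrib nat_mult_distrib
        add.commute)
  finally show ?thesis
    by (simp add: order_def)
qed

text \<open>
  A nontrivial element of least displacement less than \<open>1/4\<close> would commute with all its
  conjugates, which have the same displacement.
\<close>

theorem order_le_if_simple:
  assumes simple: "simple_group G" and fin: "finite (carrier G)" and noncomm: "\<not> comm_group G"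
    and nontriv: "\<exists>x\<in>carrier G. \<exists>i<k. \<exists>j<k. \<rho> x i j \<noteq> of_bool (i = j)"
  shows "order G \<le> (4 * k + 3) ^ k\<^sup>2"
proof (rule order_le_if_displ_ge)
  interpret simple_group G by (rule simple)
  \<comment> \<open>By simplicity the nontrivial representation is faithful, so every element other
    than \<open>\<one>\<close> has positive displacement.\<close>
  have "{x \<in> carrier G. displ x = 0} \<noteq> carrier G"
    using nontriv rho_eq_one_if_displ_eq_0 by fastforce
  then have ker: "{x \<in> carrier G. displ x = 0} = {\<one>}"
    using no_real_normal_subgroup[OF normal_kernel] by auto
  fix x assume x: "x \<in> carrier G" "x \<noteq> \<one>"
  have fin': "finite (displ ` (carrier G - {\<one>}))" "displ ` (carrier G - {\<one>}) \<noteq> {}"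
    using fin x by auto
  obtain g where g: "g \<in> carrier G" "g \<noteq> \<one>"
    and min: "\<And>y. y \<in> carrier G \<Longrightarrow> y \<noteq> \<one> \<Longrightarrow> displ g \<le> displ y"
    using Min_in[OF fin'] Min_le[OF fin'(1)] by (smt (verit) DiffE DiffI imageE imageI singleton_iff)
  have pos: "displ g > 0"
    using g ker displ_nonneg[of g] by (auto simp: order.order_iff_strict)
  show "1 / 4 \<le> displ x"
  proof (rule ccontr)
    assume "\<not> 1 / 4 \<le> displ x"
    then have lt: "displ g < 1 / 4"
      using min[OF x] by linarith
    have "g \<otimes> h = h \<otimes> g" if y: "y \<in> carrier G" and h_def: "h = y \<otimes> g \<otimes> inv y" for y h
    proof (rule ccontr)
      assume ne: "g \<otimes> h \<noteq> h \<otimes> g"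
      have h: "h \<in> carrier G" "displ h = displ g"
        using y g by (auto simp: h_def displ_conj)
      have "inv (g \<otimes> h) \<otimes> (h \<otimes> g) \<noteq> \<one>"
        using ne g h by (metis inv_closed inv_equality inv_inv m_closed)
      \<comment> \<open>The nontrivial commutator would have displacement at most
        \<open>4 * (displ g)\<^sup>2\<close>, which is below the minimum \<open>displ g\<close>
        exactly because \<open>displ g < 1 / 4\<close>.\<close>
      then have "displ g \<le> displ (inv (g \<otimes> h) \<otimes> (h \<otimes> g))"
        using g h by (intro min) auto
      also have "\<dots> \<le> 4 * displ g * displ g"
        using displ_commutator_le[OF g(1) h(1)] h(2) by simp
      also have "\<dots> < displ g"
        using pos lt by simp
      finally show False by simp
    qed
    then show False
      using comm_group_if_commutes_conjugates[OF g] noncomm by blast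
  qed
qed

end

section \<open>Orthonormal families of functions on a finite set\<close>

definition inner_on :: "'b set \<Rightarrow> ('b \<Rightarrow> real) \<Rightarrow> ('b \<Rightarrow> real) \<Rightarrow> real"
  where "inner_on S u v = (\<Sum>x\<in>S. u x * v x)"

definition orthonormal_on :: "'b set \<Rightarrow> (nat \<Rightarrow> 'b \<Rightarrow> real) \<Rightarrow> nat \<Rightarrow> bool"
  where "orthonormal_on S e k \<longleftrightarrow> (\<forall>i<k. \<forall>j<k. inner_on S (e i) (e j) = of_bool (i = j))"

lemma inner_on_commute: "inner_on S u v = inner_on S v u"
  by (simp add: inner_on_def mult.commute)

lemma inner_on_cong:
  assumes "\<And>x. x \<in> S \<Longrightarrow> u x = u' x" "\<And>x. x \<in> S \<Longrightarrow> v x = v' x"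
  shows "inner_on S u v = inner_on S u' v'"
  using assms by (simp add: inner_on_def)

lemma inner_on_add_right: "inner_on S u (\<lambda>x. v x + w x) = inner_on S u v + inner_on S u w"
  by (simp add: inner_on_def distrib_left sum.distrib)

lemma inner_on_diff_right: "inner_on S u (\<lambda>x. v x - w x) = inner_on S u v - inner_on S u w"
  by (simp add: inner_on_def right_diff_distrib sum_subtractf)

lemma inner_on_scale_right: "inner_on S u (\<lambda>x. a * v x) = a * inner_on S u v"
  by (simp add: inner_on_def sum_distrib_left mult_ac)

lemma inner_on_scale_left: "inner_on S (\<lambda>x. a * u x) v = a * inner_on S u v"
  by (simp add: inner_on_def sum_distrib_left mult_ac)

lemma inner_on_sum_right: "inner_on S u (\<lambda>x. \<Sum>i\<in>I. f i x) = (\<Sum>i\<in>I. inner_on S u (f i))"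
  unfolding inner_on_def sum_distrib_left by (rule sum.swap)

lemma inner_on_self_nonneg: "0 \<le> inner_on S u u"
  by (simp add: inner_on_def sum_nonneg)

lemma inner_on_self_eq_0_iff:
  "finite S \<Longrightarrow> inner_on S u u = 0 \<longleftrightarrow> (\<forall>x\<in>S. u x = 0)"
  by (simp add: inner_on_def sum_nonneg_eq_0_iff)

text \<open>\<open>r\<close> is \<open>v\<close> minus its orthogonal projection to the span of the
  family, and the norm identity is Pythagoras. The orthogonality serves as a Gram-Schmidt step, the
  norm identity gives Bessel's inequality.\<close>

lemma orthonormal_on_residual:
  fixes v e
  assumes orth: "orthonormal_on S e k"
  defines "r \<equiv> \<lambda>x. v x - (\<Sum>i<k. inner_on S (e i) v * e i x)"
  shows orthonormal_on_residual_orth: "j < k \<Longrightarrow> inner_on S (e j) r = 0"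
    and orthonormal_on_residual_norm:
      "inner_on S r r = inner_on S v v - (\<Sum>i<k. (inner_on S (e i) v)\<^sup>2)"
proof -
  have expand: "inner_on S u r = inner_on S u v - (\<Sum>i<k. inner_on S (e i) v * inner_on S u (e i))" for u
    unfolding r_def by (simp add: inner_on_diff_right inner_on_sum_right inner_on_scale_right)
  show 0: "inner_on S (e j) r = 0" if "j < k" for j
  proof -
    have "(\<Sum>i<k. inner_on S (e i) v * inner_on S (e j) (e i))
        = (\<Sum>i<k. inner_on S (e i) v * of_bool (i = j))"
      using orth that by (intro sum.cong) (auto simp: orthonormal_on_def)
    then show ?thesis
      using that by (simp add: expand sum_mult_of_bool)
  qed
  have "inner_on S r (e j) = 0" if "j < k" for j
    using 0[OF that] by (subst inner_on_commute)
  then have "inner_on S r r = inner_on S r v"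
    by (subst expand) simp
  also have "\<dots> = inner_on S v v - (\<Sum>i<k. (inner_on S (e i) v)\<^sup>2)"
    by (subst inner_on_commute, subst expand)
      (simp add: inner_on_commute[of S v "e _"] power2_eq_square)
  finally show "inner_on S r r = inner_on S v v - (\<Sum>i<k. (inner_on S (e i) v)\<^sup>2)" .
qed

lemma bessel_inequality_on:
  assumes "orthonormal_on S e k"
  shows "(\<Sum>i<k. (inner_on S (e i) v)\<^sup>2) \<le> inner_on S v v"
  using orthonormal_on_residual_norm[OF assms, of v]
    inner_on_self_nonneg[of S "\<lambda>x. v x - (\<Sum>i<k. inner_on S (e i) v * e i x)"] by linarith

text \<open>A longest orthonormal family in \<open>V\<close> exists because \<open>D\<close> bounds
  the length. If it failed to span some \<open>v\<close> on \<open>S\<close>, the normalized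
  residual of \<open>v\<close> would extend it.\<close>

lemma ex_complete_orthonormal_on:
  fixes V :: "('b \<Rightarrow> real) set"
  assumes fin: "finite S"
    and lin: "\<And>u v a. u \<in> V \<Longrightarrow> v \<in> V \<Longrightarrow> (\<lambda>x. u x + a * v x) \<in> V"
    and bound: "\<And>e k. orthonormal_on S e k \<Longrightarrow> (\<And>i. i < k \<Longrightarrow> e i \<in> V) \<Longrightarrow> k \<le> D"
  obtains e k where "k \<le> D" "orthonormal_on S e k" "\<And>i. i < k \<Longrightarrow> e i \<in> V"
    "\<And>v x. v \<in> V \<Longrightarrow> x \<in> S \<Longrightarrow> v x = (\<Sum>i<k. inner_on S (e i) v * e i x)"
proof -
  define P where "P k \<longleftrightarrow> (\<exists>e. orthonormal_on S e k \<and> (\<forall>i<k. e i \<in> V))" for k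
  have P0: "P 0" by (auto simp: P_def orthonormal_on_def)
  have PD: "P k \<Longrightarrow> k \<le> D" for k using bound by (auto simp: P_def)
  define k where "k = (GREATEST k. P k)"
  have "P k" unfolding k_def using P0 PD by (rule GreatestI_nat)
  then obtain e where e: "orthonormal_on S e k" "\<And>i. i < k \<Longrightarrow> e i \<in> V"
    by (auto simp: P_def)
  have max: "k' \<le> k" if "P k'" for k'
    unfolding k_def using that PD by (rule Greatest_le_nat)
  have "v x = (\<Sum>i<k. inner_on S (e i) v * e i x)" if v: "v \<in> V" and x: "x \<in> S" for v x
  proof (rule ccontr)
    assume ne: "v x \<noteq> (\<Sum>i<k. inner_on S (e i) v * e i x)"
    define r where "r = (\<lambda>x. v x - (\<Sum>i<k. inner_on S (e i) v * e i x))"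
    \<comment> \<open>The closure assumption on \<open>V\<close> handles one multiple at a time, so
      the projection is subtracted term by term.\<close>
    have "(\<lambda>x. v x - (\<Sum>i<m. inner_on S (e i) v * e i x)) \<in> V" if "m \<le> k" for m
      using that
    proof (induction m)
      case 0
      then show ?case using v by simp
    next
      case (Suc m)
      then show ?case
        using lin[OF Suc.IH e(2), of m "- inner_on S (e m) v"] by (simp add: algebra_simps)
    qed
    then have r: "r \<in> V" by (simp add: r_def)
    have orth: "inner_on S (e j) r = 0" if "j < k" for j
      unfolding r_def using orthonormal_on_residual_orth[OF e(1) that] .
    have "inner_on S r r \<noteq> 0"
      using fin x ne by (auto simp: inner_on_self_eq_0_iff r_def)
    then have pos: "inner_on S r r > 0"
      using inner_on_self_nonneg[of S r] by linarith
    define a where "a = 1 / sqrt (inner_on S r r)"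
    define e' where "e' = e(k := (\<lambda>x. a * r x))"
    \<comment> \<open>Scaling is obtained from closure under \<open>u + a v\<close> by writing
      \<open>a r\<close> as \<open>r + (a - 1) r\<close>.\<close>
    have "(\<lambda>x. r x + (a - 1) * r x) \<in> V" by (rule lin[OF r r])
    then have "(\<lambda>x. a * r x) \<in> V" by (simp add: algebra_simps)
    then have in_V: "\<forall>i<Suc k. e' i \<in> V"
      using e(2) by (auto simp: e'_def less_Suc_eq)
    have norm: "inner_on S (\<lambda>x. a * r x) (\<lambda>x. a * r x) = 1"
      unfolding inner_on_scale_left inner_on_scale_right using pos by (simp add: a_def)
    have orth': "inner_on S (e j) (\<lambda>x. a * r x) = 0" "inner_on S (\<lambda>x. a * r x) (e j) = 0"
      if "j < k" for j
      using orth[OF that]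
      by (simp_all add: inner_on_scale_left inner_on_scale_right inner_on_commute[of S r "e j"])
    have "orthonormal_on S e' (Suc k)"
      using e(1) norm orth' by (auto simp: orthonormal_on_def e'_def less_Suc_eq)
    then have "P (Suc k)" using in_V by (auto simp: P_def)
    then show False using max by fastforce
  qed
  with that[of k e] PD[OF \<open>P k\<close>] e show thesis by blast
qed

section \<open>Extremal functions of a kernel\<close>

text \<open>The squared norm of \<open>T h\<close>, where \<open>T\<close> is the operator on
  functions on \<open>S\<close> with matrix \<open>\<kappa>\<close>.\<close>

definition kernel_form :: "'b set \<Rightarrow> ('b \<Rightarrow> 'b \<Rightarrow> real) \<Rightarrow> ('b \<Rightarrow> real) \<Rightarrow> real"
  where "kernel_form S \<kappa> h = (\<Sum>x\<in>S. (inner_on S (\<kappa> x) h)\<^sup>2)"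

lemma kernel_form_nonneg: "0 \<le> kernel_form S \<kappa> h"
  by (simp add: kernel_form_def sum_nonneg)

lemma kernel_form_cong:
  "(\<And>x. x \<in> S \<Longrightarrow> h x = h' x) \<Longrightarrow> kernel_form S \<kappa> h = kernel_form S \<kappa> h'"
  unfolding kernel_form_def by (intro sum.cong arg_cong[of _ _ "\<lambda>t. t\<^sup>2"] inner_on_cong) auto

lemma kernel_form_scale: "kernel_form S \<kappa> (\<lambda>x. a * h x) = a\<^sup>2 * kernel_form S \<kappa> h"
  by (simp add: kernel_form_def inner_on_scale_right power_mult_distrib sum_distrib_left)

lemma kernel_form_parallelogram:
  "kernel_form S \<kappa> (\<lambda>x. u x + v x) + kernel_form S \<kappa> (\<lambda>x. u x - v x)
    = 2 * kernel_form S \<kappa> u + 2 * kernel_form S \<kappa> v"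
  by (simp add: kernel_form_def inner_on_add_right inner_on_diff_right power2_eq_square algebra_simps
      sum.distrib sum_subtractf sum_distrib_left)

lemma inner_on_parallelogram:
  "inner_on S (\<lambda>x. u x + v x) (\<lambda>x. u x + v x) + inner_on S (\<lambda>x. u x - v x) (\<lambda>x. u x - v x)
    = 2 * inner_on S u u + 2 * inner_on S v v"
  by (simp add: inner_on_def algebra_simps sum.distrib sum_subtractf sum_distrib_left)

text \<open>Tychonoff's theorem. Values outside \<open>S\<close> are pinned to 0, so that every
  factor of the product is compact.\<close>

lemma compact_box_functions:
  "compact {h :: 'b \<Rightarrow> real. \<forall>x. h x \<in> (if x \<in> S then {-1..1} else {0})}"
proof -
  have "compactin (product_topology (\<lambda>_. euclidean) UNIV)
      (PiE UNIV (\<lambda>x :: 'b. if x \<in> S then {-1..1 :: real} else {0}))"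
    by (auto simp: compactin_PiE)
  then show ?thesis
    by (simp add: euclidean_product_topology PiE_UNIV_domain Pi_def)
qed

text \<open>The functions of sum zero and norm one, cut off outside \<open>S\<close>, form a compact
  set, on which the continuous form has a maximum; \<open>f\<close> shows that the set is nonempty.
  Homogeneity of degree 2 extends the bound to all \<open>h\<close>.\<close>

lemma kernel_form_attains_max:
  assumes fin: "finite S" and f: "sum f S = 0" "inner_on S f f > 0"
  obtains w where "sum w S = 0" "inner_on S w w = 1"
    "\<And>h. sum h S = 0 \<Longrightarrow> kernel_form S \<kappa> h \<le> kernel_form S \<kappa> w * inner_on S h h"
proof -
  define B where "B = {h. \<forall>x. h x \<in> (if x \<in> S then {-1..1} else {0 :: real})}
      \<inter> ({h. sum h S = 0} \<inter> {h. inner_on S h h = 1})"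
  have B: "\<exists>h'\<in>B. kernel_form S \<kappa> h = kernel_form S \<kappa> h' * inner_on S h h"
    if h: "sum h S = 0" "inner_on S h h > 0" for h
  proof -
    define a where "a = 1 / sqrt (inner_on S h h)"
    have a2: "a\<^sup>2 * inner_on S h h = 1"
      using h(2) by (simp add: a_def power_divide)
    define h' where "h' x = (if x \<in> S then a * h x else 0)" for x
    have "sum h' S = a * sum h S" by (simp add: h'_def sum_distrib_left)
    then have sum: "sum h' S = 0" using h(1) by simp
    have norm: "inner_on S h' h' = 1"
      using a2 inner_on_cong[of S h' "\<lambda>x. a * h x" h' "\<lambda>x. a * h x"]
      by (simp add: h'_def inner_on_scale_left inner_on_scale_right power2_eq_square mult.assoc)
    have "h' x \<in> {-1..1}" if "x \<in> S" for x
    proof -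
      have "(h' x)\<^sup>2 \<le> (\<Sum>x\<in>S. (h' x)\<^sup>2)"
        using fin that by (intro member_le_sum) auto
      then have "(h' x)\<^sup>2 \<le> 1" using norm by (simp add: inner_on_def power2_eq_square)
      then show ?thesis by (auto simp: abs_square_le_1 abs_le_iff)
    qed
    then have "h' \<in> B" using sum norm by (auto simp: B_def h'_def)
    moreover have "kernel_form S \<kappa> h' = a\<^sup>2 * kernel_form S \<kappa> h"
      unfolding kernel_form_scale[symmetric] by (rule kernel_form_cong) (simp add: h'_def)
    ultimately show ?thesis
      using a2 by (intro bexI[of _ h']) (auto simp: mult_ac)
  qed
  have cont_sum: "continuous_on UNIV (\<lambda>h :: 'a \<Rightarrow> real. sum h S)"
    by (intro continuous_intros continuous_on_product_coordinates)
  have cont_inner: "continuous_on UNIV (\<lambda>h. inner_on S h h)"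
    unfolding inner_on_def by (intro continuous_intros continuous_on_product_coordinates)
  have cont_form: "continuous_on B (kernel_form S \<kappa>)"
    unfolding kernel_form_def inner_on_def
    by (intro continuous_intros continuous_on_subset[OF continuous_on_product_coordinates]) auto
  have "compact B"
    unfolding B_def
    by (intro compact_Int_closed closed_Int compact_box_functions closed_Collect_eq cont_sum cont_inner
        continuous_on_const)
  moreover have "B \<noteq> {}" using B[OF f] by blast
  ultimately obtain w where w: "w \<in> B" "\<And>h. h \<in> B \<Longrightarrow> kernel_form S \<kappa> h \<le> kernel_form S \<kappa> w"
    using continuous_attains_sup[OF _ _ cont_form] by blast
  have "kernel_form S \<kappa> h \<le> kernel_form S \<kappa> w * inner_on S h h" if h: "sum h S = 0" for h
  proof (cases "inner_on S h h = 0")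
    case True
    \<comment> \<open>A function of norm zero cannot be normalized, but it vanishes on
      \<open>S\<close>, and so does its form.\<close>
    then have "kernel_form S \<kappa> h = kernel_form S \<kappa> (\<lambda>x. 0 * h x)"
      using fin by (intro kernel_form_cong) (simp add: inner_on_self_eq_0_iff)
    also have "\<dots> = 0"
      by (subst kernel_form_scale) simp
    finally show ?thesis using True by simp
  next
    case False
    then have "inner_on S h h > 0" using inner_on_self_nonneg[of S h] by linarith
    then show ?thesis
      using B[OF h] w(2) inner_on_self_nonneg[of S h] by (metis mult_right_mono)
  qed
  with that[of w] w(1) show thesis by (auto simp: B_def)
qed

text \<open>
  The extremal functions play the role of the top singular space of \<open>\<kappa>\<close>. By the parallelogram law
  they are closed under linear combinations, without any spectral theorem.
\<close>

definition extremal_functions :: "'b set \<Rightarrow> ('b \<Rightarrow> 'b \<Rightarrow> real) \<Rightarrow> real \<Rightarrow> ('b \<Rightarrow> real) set"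
  where "extremal_functions S \<kappa> \<mu> = {h. sum h S = 0 \<and> kernel_form S \<kappa> h = \<mu> * inner_on S h h}"

lemma extremal_functions_lin:
  assumes max: "\<And>h. sum h S = 0 \<Longrightarrow> kernel_form S \<kappa> h \<le> \<mu> * inner_on S h h"
    and u: "u \<in> extremal_functions S \<kappa> \<mu>" and v: "v \<in> extremal_functions S \<kappa> \<mu>"
  shows "(\<lambda>x. u x + a * v x) \<in> extremal_functions S \<kappa> \<mu>"
proof -
  define v' where "v' x = a * v x" for x
  have v': "sum v' S = 0" "kernel_form S \<kappa> v' = \<mu> * inner_on S v' v'"
    using v unfolding v'_def[abs_def]
    by (auto simp: extremal_functions_def kernel_form_scale inner_on_scale_left inner_on_scale_right
        power2_eq_square simp flip: sum_distrib_left)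
  have u': "sum u S = 0" "kernel_form S \<kappa> u = \<mu> * inner_on S u u"
    using u by (auto simp: extremal_functions_def)
  have sums: "(\<Sum>x\<in>S. u x + v' x) = 0" "(\<Sum>x\<in>S. u x - v' x) = 0"
    using u' v' by (simp_all add: sum.distrib sum_subtractf)
  have "kernel_form S \<kappa> (\<lambda>x. u x + v' x) + kernel_form S \<kappa> (\<lambda>x. u x - v' x)
      = \<mu> * (inner_on S (\<lambda>x. u x + v' x) (\<lambda>x. u x + v' x) + inner_on S (\<lambda>x. u x - v' x) (\<lambda>x. u x - v' x))"
    unfolding kernel_form_parallelogram inner_on_parallelogram u'(2) v'(2) by (simp add: algebra_simps)
  \<comment> \<open>The upper bounds for \<open>u + v'\<close> and \<open>u - v'\<close> add up to
    an equality, so each is an equality.\<close>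
  then have "kernel_form S \<kappa> (\<lambda>x. u x + v' x) = \<mu> * inner_on S (\<lambda>x. u x + v' x) (\<lambda>x. u x + v' x)"
    using max[OF sums(1)] max[OF sums(2)] by (simp add: distrib_left)
  then show ?thesis
    using sums(1) by (simp add: extremal_functions_def v'_def)
qed

text \<open>Each member of the family contributes \<open>\<mu>\<close> to the sum of the forms.
  Bessel's inequality, applied to every row \<open>\<kappa> x\<close>, bounds that sum by the
  squared Hilbert--Schmidt norm.\<close>

lemma orthonormal_extremal_functions_card:
  assumes e: "orthonormal_on S e k" "\<And>i. i < k \<Longrightarrow> e i \<in> extremal_functions S \<kappa> \<mu>"
  shows "real k * \<mu> \<le> (\<Sum>x\<in>S. inner_on S (\<kappa> x) (\<kappa> x))"
proof -
  have "real k * \<mu> = (\<Sum>i<k. kernel_form S \<kappa> (e i))"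
    using e by (simp add: extremal_functions_def orthonormal_on_def)
  also have "\<dots> = (\<Sum>x\<in>S. \<Sum>i<k. (inner_on S (e i) (\<kappa> x))\<^sup>2)"
    unfolding kernel_form_def inner_on_commute[of S "\<kappa> _"] by (rule sum.swap)
  also have "\<dots> \<le> (\<Sum>x\<in>S. inner_on S (\<kappa> x) (\<kappa> x))"
    using e(1) by (intro sum_mono bessel_inequality_on)
  finally show ?thesis .
qed

section \<open>Translation-invariant function spaces\<close>

lemma (in group) sum_left_translate:
  assumes "g \<in> carrier G"
  shows "(\<Sum>y\<in>carrier G. f (g \<otimes> y)) = sum f (carrier G)"
  by (rule sum.reindex_bij_witness[of _ "\<lambda>y. inv g \<otimes> y" "\<lambda>y. g \<otimes> y"])
    (use assms in \<open>auto simp flip: m_assoc\<close>)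

lemma (in group) sum_right_translate:
  assumes "g \<in> carrier G"
  shows "(\<Sum>y\<in>carrier G. f (y \<otimes> g)) = sum f (carrier G)"
  by (rule sum.reindex_bij_witness[of _ "\<lambda>y. y \<otimes> inv g" "\<lambda>y. y \<otimes> g"])
    (use assms in \<open>auto simp: m_assoc\<close>)

text \<open>Left translations act on \<open>V\<close> by isometries, so in a complete orthonormal
  family their matrices are orthogonal. If all were the identity, the members of the family would be
  constant, hence zero because of sum zero.\<close>

lemma (in group) ex_orth_rep:
  fixes V :: "('a \<Rightarrow> real) set"
  assumes fin: "finite (carrier G)"
    and lin: "\<And>u v a. u \<in> V \<Longrightarrow> v \<in> V \<Longrightarrow> (\<lambda>x. u x + a * v x) \<in> V"
    and bound: "\<And>e k. orthonormal_on (carrier G) e k \<Longrightarrow> (\<And>i. i < k \<Longrightarrow> e i \<in> V) \<Longrightarrow> k \<le> D"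
    and invar: "\<And>g h. g \<in> carrier G \<Longrightarrow> h \<in> V \<Longrightarrow> (\<lambda>y. h (inv g \<otimes> y)) \<in> V"
    and sum0: "\<And>h. h \<in> V \<Longrightarrow> sum h (carrier G) = 0"
    and w: "w \<in> V" "inner_on (carrier G) w w \<noteq> 0"
  obtains k \<rho> where "k \<le> D" "orth_rep G k \<rho>"
    "\<exists>x\<in>carrier G. \<exists>i<k. \<exists>j<k. \<rho> x i j \<noteq> of_bool (i = j)"
proof -
  let ?S = "carrier G"
  obtain e k where k: "k \<le> D" and orth: "orthonormal_on ?S e k" and e: "\<And>i. i < k \<Longrightarrow> e i \<in> V"
    and complete: "\<And>v x. v \<in> V \<Longrightarrow> x \<in> ?S \<Longrightarrow> v x = (\<Sum>i<k. inner_on ?S (e i) v * e i x)"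
  proof (rule ex_complete_orthonormal_on[of ?S V D])
    show "finite ?S" by (rule fin)
    show "(\<lambda>x. u x + a * v x) \<in> V" if "u \<in> V" "v \<in> V" for u v a
      using that by (rule lin)
    show "k \<le> D" if "orthonormal_on ?S e k" "\<And>i. i < k \<Longrightarrow> e i \<in> V" for e k
      using that by (rule bound)
  qed (rule that; assumption)
  \<comment> \<open>The matrix of translation by \<open>g\<close>; the inverse makes the action a
    left action, so that \<open>\<rho>\<close> is multiplicative.\<close>
  define \<rho> where "\<rho> g i j = inner_on ?S (e i) (\<lambda>y. e j (inv g \<otimes> y))" for g i j
  have translate: "e j (inv g \<otimes> y) = (\<Sum>i<k. \<rho> g i j * e i y)"
    if "g \<in> ?S" "y \<in> ?S" "j < k" for g y j
    unfolding \<rho>_def using complete[OF invar[OF that(1) e[OF that(3)]] that(2)] .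
  have rep: "orth_rep G k \<rho>"
  proof (intro orth_rep.intro orth_rep_axioms.intro)
    show "group G" ..
  next
    fix x y i j assume x: "x \<in> ?S" and y: "y \<in> ?S" and ij: "i < k" "j < k"
    have "\<rho> (x \<otimes> y) i j = inner_on ?S (e i) (\<lambda>z. \<Sum>l<k. \<rho> y l j * e l (inv x \<otimes> z))"
      unfolding \<rho>_def[of "x \<otimes> y"]
    proof (rule inner_on_cong)
      fix z assume z: "z \<in> ?S"
      have "inv (x \<otimes> y) \<otimes> z = inv y \<otimes> (inv x \<otimes> z)"
        using x y z by (simp add: inv_mult_group m_assoc)
      then show "e j (inv (x \<otimes> y) \<otimes> z) = (\<Sum>l<k. \<rho> y l j * e l (inv x \<otimes> z))"
        using x y z ij translate[of y "inv x \<otimes> z" j] by simp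
    qed simp
    also have "\<dots> = (\<Sum>l<k. \<rho> y l j * \<rho> x i l)"
      by (simp add: inner_on_sum_right inner_on_scale_right \<rho>_def[of x])
    finally show "\<rho> (x \<otimes> y) i j = (\<Sum>l<k. \<rho> x i l * \<rho> y l j)"
      by (simp add: mult.commute)
  next
    fix i j assume ij: "i < k" "j < k"
    have "\<rho> \<one> i j = inner_on ?S (e i) (e j)"
      unfolding \<rho>_def by (rule inner_on_cong) auto
    then show "\<rho> \<one> i j = of_bool (i = j)"
      using orth ij by (simp add: orthonormal_on_def)
  next
    fix x i j assume x: "x \<in> ?S"
    \<comment> \<open>Substituting \<open>x \<otimes> y\<close> for \<open>y\<close> moves the
      translation to the other factor: translations are isometries.\<close>
    have "\<rho> x j i = (\<Sum>y\<in>?S. e j (x \<otimes> y) * e i (inv x \<otimes> (x \<otimes> y)))"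
      unfolding \<rho>_def inner_on_def
      by (rule sum_left_translate[OF x, of "\<lambda>y. e j y * e i (inv x \<otimes> y)", symmetric])
    also have "\<dots> = \<rho> (inv x) i j"
      unfolding \<rho>_def inner_on_def
      using x by (intro sum.cong) (auto simp: mult.commute simp flip: m_assoc)
    finally show "\<rho> (inv x) i j = \<rho> x j i" ..
  qed
  have "\<exists>x\<in>?S. \<exists>i<k. \<exists>j<k. \<rho> x i j \<noteq> of_bool (i = j)"
  proof (rule ccontr)
    assume triv: "\<not> ?thesis"
    have "k > 0"
    proof (rule ccontr)
      assume "\<not> k > 0"
      then have "w x = 0" if "x \<in> ?S" for x using complete[OF w(1) that] by simp
      then show False using w(2) by (simp add: inner_on_def)
    qed
    have const: "e 0 x = e 0 \<one>" if x: "x \<in> ?S" for x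
    proof -
      \<comment> \<open>The value at \<open>x\<close> is the value at \<open>\<one>\<close> of the
        translate of \<open>e 0\<close> by \<open>inv x\<close>, which is \<open>e 0\<close> itself
        if the representation is trivial.\<close>
      have "e 0 x = (\<Sum>i<k. \<rho> (inv x) i 0 * e i \<one>)"
        using translate[of "inv x" \<one> 0] x \<open>k > 0\<close> by simp
      also have "\<dots> = (\<Sum>i<k. of_bool (0 = i) * e i \<one>)"
      proof (rule sum.cong)
        fix i assume "i \<in> {..<k}"
        then have "\<rho> (inv x) i 0 = of_bool (i = 0)"
          using triv inv_closed[OF x] \<open>k > 0\<close> by blast
        then show "\<rho> (inv x) i 0 * e i \<one> = of_bool (0 = i) * e i \<one>"
          by (auto simp: of_bool_def)
      qed simp
      also have "\<dots> = e 0 \<one>"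
        using \<open>k > 0\<close> by (subst sum_of_bool_mult) auto
      finally show ?thesis .
    qed
    have "sum (e 0) ?S = (\<Sum>x\<in>?S. e 0 \<one>)"
      using const by (rule sum.cong[OF refl])
    then have "e 0 \<one> = 0"
      using sum0[OF e[OF \<open>k > 0\<close>]] fin by auto
    then have "e 0 x = 0" if "x \<in> ?S" for x
      using const[OF that] by simp
    then have "inner_on ?S (e 0) (e 0) = 0" by (simp add: inner_on_def)
    then show False using orth \<open>k > 0\<close> by (simp add: orthonormal_on_def)
  qed
  with that k rep show thesis by blast
qed

section \<open>Product-free sets\<close>

text \<open>With \<open>a = |A|\<close> and \<open>n = |G|\<close>, testing the operator on the
  centered indicator gives \<open>\<mu> \<ge> (a\<^sup>2 / n)\<^sup>2\<close>, while its squared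
  Hilbert--Schmidt norm is \<open>n a\<close>. Comparing the two yields the bound on
  \<open>k\<close>.\<close>

lemma (in group) product_free_orth_rep:
  assumes fin: "finite (carrier G)" and pf: "product_free G A" and ne: "A \<noteq> {}"
  obtains k \<rho> where "real k * real (card A) ^ 3 \<le> real (order G) ^ 3" "orth_rep G k \<rho>"
    "\<exists>x\<in>carrier G. \<exists>i<k. \<exists>j<k. \<rho> x i j \<noteq> of_bool (i = j)"
proof -
  let ?S = "carrier G"
  have A: "A \<subseteq> ?S" and free: "\<And>x y. x \<in> A \<Longrightarrow> y \<in> A \<Longrightarrow> x \<otimes> y \<notin> A"
    using pf by (auto simp: product_free_def)
  have fin_A: "finite A" using A fin by (rule finite_subset)
  define a where "a = real (card A)"
  define n where "n = real (order G)"
  have a: "a > 0" using fin_A ne by (simp add: a_def card_gt_0_iff)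
  have n: "n > 0" using fin by (simp add: n_def order_gt_0_iff_finite)
  define \<kappa> where "\<kappa> x y = (of_bool (x \<otimes> y \<in> A) :: real)" for x y
  \<comment> \<open>Subtracting the density gives the indicator of \<open>A\<close> sum
    zero.\<close>
  define f where "f y = of_bool (y \<in> A) - a / n" for y
  have sum_A: "(\<Sum>y\<in>?S. of_bool (y \<in> A)) = a"
    using A fin by (simp add: a_def Int_absorb1 sum.If_cases of_bool_def)
  have sum_\<kappa>: "(\<Sum>y\<in>?S. \<kappa> x y) = a" if "x \<in> ?S" for x
    unfolding \<kappa>_def using sum_left_translate[OF that, of "\<lambda>y. of_bool (y \<in> A) :: real"] sum_A by simp
  have sum_f: "sum f ?S = 0"
    using n sum_A by (simp add: f_def sum_subtractf flip: order_def n_def)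
  define p where "p = a / n"
  have "inner_on ?S f f = (\<Sum>y\<in>?S. of_bool (y \<in> A) - 2 * p * of_bool (y \<in> A) + p\<^sup>2)"
    unfolding inner_on_def by (intro sum.cong) (auto simp: f_def power2_eq_square algebra_simps simp flip: p_def)
  also have "\<dots> = a - 2 * p * a + n * p\<^sup>2"
    using sum_A by (simp add: sum.distrib sum_subtractf flip: sum_distrib_left order_def n_def)
  also have "\<dots> = a - a\<^sup>2 / n"
    using n by (simp add: p_def power2_eq_square)
  also have "\<dots> \<le> a" using n by simp
  finally have f_le: "inner_on ?S f f \<le> a" .
  \<comment> \<open>Since \<open>\<one> \<otimes> \<one> = \<one>\<close>, the identity is not in
    \<open>A\<close>; hence \<open>f\<close> is not zero and the maximum is taken over a nonempty
    set.\<close>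
  have "\<one> \<notin> A" using free[of \<one> \<one>] by auto
  then have "f \<one> \<noteq> 0" using a n by (simp add: f_def)
  then have "inner_on ?S f f \<noteq> 0" using fin by (auto simp: inner_on_self_eq_0_iff)
  then have f_pos: "inner_on ?S f f > 0" using inner_on_self_nonneg[of ?S f] by linarith
  obtain w where w: "sum w ?S = 0" "inner_on ?S w w = 1"
    and max: "\<And>h. sum h ?S = 0 \<Longrightarrow> kernel_form ?S \<kappa> h \<le> kernel_form ?S \<kappa> w * inner_on ?S h h"
    using kernel_form_attains_max[OF fin sum_f f_pos] by blast
  define \<mu> where "\<mu> = kernel_form ?S \<kappa> w"
  let ?V = "extremal_functions ?S \<kappa> \<mu>"
  have \<kappa>_f: "inner_on ?S (\<kappa> x) f = - (a\<^sup>2 / n)" if x: "x \<in> A" for x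
  proof -
    \<comment> \<open>Product-freeness: for \<open>x\<close> and \<open>y\<close> in
      \<open>A\<close> the entry \<open>\<kappa> x y\<close> is 0, so only the constant part of
      \<open>f\<close> survives.\<close>
    have "inner_on ?S (\<kappa> x) f = (\<Sum>y\<in>?S. - (a / n) * \<kappa> x y)"
      unfolding inner_on_def using free[OF x] by (intro sum.cong) (auto simp: f_def \<kappa>_def)
    also have "\<dots> = - (a / n) * a"
      using sum_\<kappa>[of x] x A unfolding sum_distrib_left[symmetric] by auto
    finally show ?thesis by (simp add: power2_eq_square)
  qed
  \<comment> \<open>Only the rows with \<open>x \<in> A\<close> are kept, where the image of
    \<open>f\<close> is known exactly.\<close>
  have "a * (a\<^sup>2 / n)\<^sup>2 = (\<Sum>x\<in>A. (inner_on ?S (\<kappa> x) f)\<^sup>2)"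
    by (simp add: \<kappa>_f a_def)
  also have "\<dots> \<le> kernel_form ?S \<kappa> f"
    unfolding kernel_form_def using fin A by (intro sum_mono2) auto
  also have "\<dots> \<le> \<mu> * inner_on ?S f f"
    using max[OF sum_f] by (simp add: \<mu>_def)
  also have "\<dots> \<le> \<mu> * a"
    using f_le by (intro mult_left_mono) (simp_all add: \<mu>_def kernel_form_nonneg)
  finally have \<mu>_ge: "(a\<^sup>2 / n)\<^sup>2 \<le> \<mu>"
    using a by (simp add: mult.commute)
  \<comment> \<open>The entries are 0 or 1, so the squared norm of a row is its sum.\<close>
  have "inner_on ?S (\<kappa> x) (\<kappa> x) = a" if "x \<in> ?S" for x
    using sum_\<kappa>[OF that] by (simp add: inner_on_def \<kappa>_def flip: of_bool_conj)
  then have trace: "(\<Sum>x\<in>?S. inner_on ?S (\<kappa> x) (\<kappa> x)) = n * a"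
    by (simp flip: order_def n_def)
  have dim: "real k * a ^ 3 \<le> n ^ 3"
    if "orthonormal_on ?S e k" "\<And>i. i < k \<Longrightarrow> e i \<in> ?V" for e k
  proof -
    have "real k * (a\<^sup>2 / n)\<^sup>2 \<le> real k * \<mu>"
      using \<mu>_ge by (intro mult_left_mono) auto
    also have "\<dots> \<le> n * a"
      using orthonormal_extremal_functions_card[OF that] trace by simp
    finally have "real k * (a ^ 3 * a) \<le> n ^ 3 * a"
      using n by (simp add: power_divide field_simps power2_eq_square power3_eq_cube)
    then show ?thesis
      using a by (simp flip: mult.assoc)
  qed
  define D where "D = nat \<lfloor>n ^ 3 / a ^ 3\<rfloor>"
  have D: "k \<le> D \<longleftrightarrow> real k * a ^ 3 \<le> n ^ 3" for k
    using a n by (simp add: D_def le_nat_iff le_floor_iff pos_le_divide_eq)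
  have invar: "(\<lambda>y. h (inv g \<otimes> y)) \<in> ?V" if g: "g \<in> ?S" and h: "h \<in> ?V" for g h
  proof -
    have tr: "(\<Sum>y\<in>?S. F (inv g \<otimes> y)) = sum F ?S" for F :: "'a \<Rightarrow> real"
      using g by (intro sum_left_translate) auto
    \<comment> \<open>\<open>\<kappa> x y\<close> depends only on \<open>x \<otimes> y\<close>, so
      translating \<open>h\<close> by \<open>g\<close> replaces the row \<open>x\<close> by the row
      \<open>x \<otimes> g\<close>, which only permutes the rows.\<close>
    have "inner_on ?S (\<kappa> x) (\<lambda>y. h (inv g \<otimes> y)) = inner_on ?S (\<kappa> (x \<otimes> g)) h" if x: "x \<in> ?S" for x
    proof -
      have "inner_on ?S (\<kappa> x) (\<lambda>y. h (inv g \<otimes> y))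
          = (\<Sum>y\<in>?S. \<kappa> (x \<otimes> g) (inv g \<otimes> y) * h (inv g \<otimes> y))"
        unfolding inner_on_def
      proof (intro sum.cong refl)
        fix y assume y: "y \<in> ?S"
        have "x \<otimes> g \<otimes> (inv g \<otimes> y) = x \<otimes> y"
          using x y g by (metis inv_closed m_assoc m_closed r_inv l_one)
        then show "\<kappa> x y * h (inv g \<otimes> y) = \<kappa> (x \<otimes> g) (inv g \<otimes> y) * h (inv g \<otimes> y)"
          by (simp add: \<kappa>_def)
      qed
      then show ?thesis
        unfolding inner_on_def using tr[of "\<lambda>y. \<kappa> (x \<otimes> g) y * h y"] by simp
    qed
    then have "kernel_form ?S \<kappa> (\<lambda>y. h (inv g \<otimes> y)) = (\<Sum>x\<in>?S. (inner_on ?S (\<kappa> (x \<otimes> g)) h)\<^sup>2)"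
      by (simp add: kernel_form_def)
    also have "\<dots> = kernel_form ?S \<kappa> h"
      unfolding kernel_form_def
      by (rule sum_right_translate[OF g, of "\<lambda>x. (inner_on ?S (\<kappa> x) h)\<^sup>2"])
    finally show ?thesis
      using h tr[of h] tr[of "\<lambda>y. h y * h y"] by (simp add: extremal_functions_def inner_on_def)
  qed
  obtain k \<rho> where "k \<le> D" "orth_rep G k \<rho>"
    "\<exists>x\<in>?S. \<exists>i<k. \<exists>j<k. \<rho> x i j \<noteq> of_bool (i = j)"
  proof (rule ex_orth_rep[of ?V D w])
    show "finite ?S" by (rule fin)
    show "(\<lambda>x. u x + t * v x) \<in> ?V" if "u \<in> ?V" "v \<in> ?V" for u v t
      using max that unfolding \<mu>_def by (rule extremal_functions_lin)
    show "k \<le> D" if "orthonormal_on ?S e k" "\<And>i. i < k \<Longrightarrow> e i \<in> ?V" for e k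
      unfolding D using that by (rule dim)
    show "(\<lambda>y. h (inv g \<otimes> y)) \<in> ?V" if "g \<in> ?S" "h \<in> ?V" for g h
      using that by (rule invar)
    show "sum h ?S = 0" if "h \<in> ?V" for h
      using that by (simp add: extremal_functions_def)
    show "w \<in> ?V" using w by (simp add: extremal_functions_def \<mu>_def)
    show "inner_on ?S w w \<noteq> 0" using w by simp
  qed (rule that; assumption)
  with that D show thesis by (auto simp: a_def n_def)
qed

section \<open>From density to a bound on the group order\<close>

theorem corollary3p11:
  fixes c :: real
  assumes "c > 0"
  shows "finite_up_to_iso
    {G :: 'a monoid. simple_group G \<and> finite (carrier G) \<and> \<not> comm_group G \<and>
      (\<exists>A. product_free G A \<and> real (card A) \<ge> c * real (order G))}"
proof -
  \<comment> \<open>For density at least \<open>c\<close> the bound on \<open>k\<close> becomes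
    \<open>k * c ^ 3 \<le> 1\<close>, so \<open>D\<close> bounds the dimension in terms of
    \<open>c\<close> alone.\<close>
  define D where "D = nat \<lfloor>1 / c ^ 3\<rfloor>"
  have "order G \<le> (4 * D + 3) ^ D\<^sup>2"
    if simple: "simple_group G" and fin: "finite (carrier G)" and noncomm: "\<not> comm_group G"
      and pf: "product_free G A" and card: "real (card A) \<ge> c * real (order G)"
    for G :: "'a monoid" and A
  proof -
    interpret simple_group G by (rule simple)
    have n: "real (order G) > 0" using order_gt_one by simp
    then have "real (card A) > 0" using card \<open>c > 0\<close> by (metis less_le_trans mult_pos_pos)
    then have "A \<noteq> {}" by auto
    then obtain k \<rho> where k: "real k * real (card A) ^ 3 \<le> real (order G) ^ 3"
      and rep: "orth_rep G k \<rho>"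
      and nontriv: "\<exists>x\<in>carrier G. \<exists>i<k. \<exists>j<k. \<rho> x i j \<noteq> of_bool (i = j)"
      using product_free_orth_rep[OF fin pf] by blast
    have "real k * (c * real (order G)) ^ 3 \<le> real k * real (card A) ^ 3"
      using card n \<open>c > 0\<close> by (intro mult_left_mono power_mono) auto
    then have "(real k * c ^ 3) * real (order G) ^ 3 \<le> 1 * real (order G) ^ 3"
      using k by (simp add: power_mult_distrib mult.assoc)
    then have "real k * c ^ 3 \<le> 1"
      using n by (metis mult_le_cancel_right_pos zero_less_power)
    then have "k \<le> D"
      using \<open>c > 0\<close> by (simp add: D_def le_nat_iff le_floor_iff pos_le_divide_eq)
    have "order G \<le> (4 * k + 3) ^ k\<^sup>2"
      using orth_rep.order_le_if_simple[OF rep simple fin noncomm nontriv] .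
    also have "\<dots> \<le> (4 * D + 3) ^ k\<^sup>2"
      using \<open>k \<le> D\<close> by (intro power_mono) auto
    also have "\<dots> \<le> (4 * D + 3) ^ D\<^sup>2"
      using \<open>k \<le> D\<close> by (intro power_increasing power_mono) auto
    finally show ?thesis .
  qed
  then show ?thesis
    by (intro finite_up_to_iso_if_order_le[where N = "(4 * D + 3) ^ D\<^sup>2"])
      (auto simp: simple_group_def)
qed

end
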